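(* Let $\mathcal{V}_{\mathcal{C}}=\Pi_{\mathcal{C}}\mathcal{V}$ be the contract set. Let $\phi\in\Phi$ be a feasible control policy for the problem minimize $\ \mathbb{E}\big[\widetilde{x}^\top R_x\widetilde{x}+\widetilde{u}^\top R_u\widetilde{u}\big]$ over $\phi\in\Phi$ subject to, for all $(w,v_{\mathcal{C}})\in\mathcal{W}\times\mathcal{V}_{\mathcal{C}}$, $$\widetilde{u}=\phi(w,v_{\mathcal{C}}),\qquad \Pi_{\mathcal{C}}\widetilde{x}\in\mathcal{V}_{\mathcal{C}},\qquad \widetilde{x}=\widetilde{B}\widetilde{u}+\widetilde{L}w+\widetilde{H}v_{\mathcal{C}},\qquad F_x\widetilde{x}+F_u\widetilde{u}+F_ww\le g.$$ Then $\phi$ is also feasible for the problem minimize $\ \mathbb{E}\big[x^\top R_xx+u^\top R_uu\big]$ over $\phi\in\Phi$ subject to, for all $w\in\mathcal{W}$, $$u=\phi(w,x_{\mathcal{C}}),\qquad x=Bu+Lw,\qquad F_xx+F_uu+F_ww\le g.$$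
   Context: System. There are $N$ subsystems indexed by $V=\{1,\dots,N\}$ and a finite horizon $T\ge 1$. Subsystem $i$ has state $x_i(t)\in\mathbb{R}^{n_x^i}$, input $u_i(t)\in\mathbb{R}^{n_u^i}$, disturbance $w_i(t)\in\mathbb{R}^{n_x^i}$, with $$x_i(t+1)=\sum_{j=1}^N\big(A_{ij}(t)x_j(t)+B_{ij}(t)u_j(t)\big)+w_i(t),\quad t=0,\dots,T-1.$$ Put $n_x=\sum_i n_x^i$, $n_u=\sum_i n_u^i$, $N_x=n_x(T+1)$, $N_u=n_uT$, $w(-1):=x(0)$, $x=(x(0),\dots,x(T))\in\mathbb{R}^{N_x}$, $u=(u(0),\dots,u(T-1))\in\mathbb{R}^{N_u}$, $w=(w(-1),w(0),\dots,w(T-1))\in\mathbb{R}^{N_x}$, where $x(t),u(t),w(t)$ stack the subsystem components. $B,L$ are the matrices for which the dynamics read $x=Bu+Lw$. The disturbance trajectory $w$ is a zero-mean random vector whose support $\mathcal{W}\subset\mathbb{R}^{N_x}$ is convex and compact with nonempty interior. Given data: $F_x\in\mathbb{R}^{m\times N_x}$, $F_u\in\mathbb{R}^{m\times N_u}$, $F_w\in\mathbb{R}^{m\times N_x}$, $g\in\mathbb{R}^m$, and symmetric positive semidefinite $R_x\in\mathbb{R}^{N_x\times N_x}$, $R_u\in\mathbb{R}^{N_u\times N_u}$. Vector inequalities are componentwise. For a sequence, $y^{s:t}=(y(s),\dots,y(t))$. Information structure. A directed graph $G_I=(V,E_I)$ is given; $(j,i)\in E_I$ means subsystem $i$ measures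 $x_j$. Let $V_I^-(i)=\{j:(j,i)\in E_I\}$, $V_A^-(i)=\{j:\exists t\in\{0,\dots,T-1\},\,A_{ij}(t)\ne0\}$, $V_B^-(i)=\{j:\exists t\in\{0,\dots,T-1\},\,B_{ij}(t)\neq0\}$. Define $$\mathcal{N}(i)=\Big\{j\in V_I^-(i): V_A^-(j)\subseteq V_I^-(i),\ \bigcup_{k\in V_B^-(j)}V_I^-(k)\subseteq V_I^-(i)\Big\},\qquad \mathcal{C}(i)=V_I^-(i)\setminus\mathcal{N}(i),\qquad \mathcal{C}=\bigcup_{i\in V}\mathcal{C}(i).$$ For a trajectory $x\in\mathbb{R}^{N_x}$, $x_{\mathcal{C}}=\Pi_{\mathcal{C}}x\in\mathbb{R}^{N_x^{\mathcal{C}}}$ denotes the subvector $(x_{\mathcal{C}}(0),\dots,x_{\mathcal{C}}(T))$, where $x_{\mathcal{C}}(t)$ stacks $x_j(t)$, $j\in\mathcal{C}$, in ascending order; $\Pi_{\mathcal{C}}$ is the corresponding coordinate-projection matrix. Policies. $\Phi$ is the set of policies $\phi=(\phi_i(\cdot,t))_{i,t}$, with measurable $\phi_i(\cdot,t)$, mapping $(w,y)\in\mathbb{R}^{N_x}\times\mathbb{R}^{N_x^{\mathcal{C}}}$ to an input trajectory $\phi(w,y)\in\mathbb{R}^{N_u}$ whose $(i,t)$ component is the function $\phi_i(\cdot,t)$ of $\{y_j^{0:t}: j\in\mathcal{C}(i)\}$ and $\{w_j^{-1:t-1}: j\in\mathcal{N}(i)\}$ only. In the second problem, by causality, $x$ and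 $u$ are determined recursively in time by $w$ and $\phi$. Surrogate system. The fictitious disturbance trajectory $v=(v(0),\dots,v(T))\in\mathbb{R}^{N_x}$ is a random vector with given distribution, whose support $\mathcal{V}\subset\mathbb{R}^{N_x}$ is convex and compact (and, being a support, nonempty); the support of $(w,v)$ is $\mathcal{W}\times\mathcal{V}$, and $v_{\mathcal{C}}=\Pi_{\mathcal{C}}v$. Given $\widetilde{u}\in\mathbb{R}^{N_u}$, the surrogate state $\widetilde{x}$ satisfies $\widetilde{x}(0)=w(-1)$ and $$\widetilde{x}_i(t+1)=\sum_{j\in V\setminus\mathcal{C}(i)}A_{ij}(t)\widetilde{x}_j(t)+\sum_{j\in\mathcal{C}(i)}A_{ij}(t)v_j(t)+\sum_{j=1}^NB_{ij}(t)\widetilde{u}_j(t)+w_i(t).$$ The matrices $\widetilde{B},\widetilde{L},\widetilde{H}$ are those for which this reads $\widetilde{x}=\widetilde{B}\widetilde{u}+\widetilde{L}w+\widetilde{H}v_{\mathcal{C}}$. *)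

theory Defs
  imports "HOL-Probability.Probability"
begin

text \<open>
  The block dimensions depend on the subsystem, so the Euclidean space of dimension \<open>card I\<close> is
  rendered as the space of extensional functions on a finite index set \<open>I\<close>, with the product
  topology \<^term>\<open>powertop_real I\<close> and the product Borel algebra. An entry of a stacked vector is
  addressed by (time block, subsystem, component) instead of by its position in the stack.
\<close>

type_synonym idx = "nat \<times> nat \<times> nat"
type_synonym traj = "idx \<Rightarrow> real"
type_synonym 'r mtx = "'r \<Rightarrow> idx \<Rightarrow> real"

abbreviation rvec :: "'a set \<Rightarrow> ('a \<Rightarrow> real) set" where
  "rvec I \<equiv> I \<rightarrow>\<^sub>E UNIV"

abbreviation borel_rvec :: "'a set \<Rightarrow> ('a \<Rightarrow> real) measure" where
  "borel_rvec I \<equiv> Pi\<^sub>M I (\<lambda>_. borel)"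

definition mvec :: "'c set \<Rightarrow> ('r \<Rightarrow> 'c \<Rightarrow> real) \<Rightarrow> ('c \<Rightarrow> real) \<Rightarrow> 'r \<Rightarrow> real" where
  "mvec J P x r = (\<Sum>c\<in>J. P r c * x c)"

definition quad_form :: "'a set \<Rightarrow> ('a \<Rightarrow> 'a \<Rightarrow> real) \<Rightarrow> ('a \<Rightarrow> real) \<Rightarrow> real" where
  "quad_form I R x = (\<Sum>p\<in>I. \<Sum>q\<in>I. x p * R p q * x q)"

definition sym_psd :: "'a set \<Rightarrow> ('a \<Rightarrow> 'a \<Rightarrow> real) \<Rightarrow> bool" where
  "sym_psd I R \<longleftrightarrow> (\<forall>p\<in>I. \<forall>q\<in>I. R p q = R q p) \<and> (\<forall>x\<in>rvec I. 0 \<le> quad_form I R x)"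

definition convex_rvec :: "'a set \<Rightarrow> ('a \<Rightarrow> real) set \<Rightarrow> bool" where
  "convex_rvec I S \<longleftrightarrow> S \<subseteq> rvec I \<and>
     (\<forall>x\<in>S. \<forall>y\<in>S. \<forall>a\<ge>0. \<forall>b\<ge>0. a + b = 1 \<longrightarrow> (\<lambda>p\<in>I. a * x p + b * y p) \<in> S)"

definition measure_support :: "'a topology \<Rightarrow> 'a measure \<Rightarrow> 'a set" where
  "measure_support X \<mu> = {x \<in> topspace X. \<forall>U. openin X U \<and> x \<in> U \<longrightarrow> emeasure \<mu> U > 0}"

text \<open>
  \<open>Amat S t i j\<close> is the matrix $A_{ij}(t)$ with \<open>xdim S i\<close> rows and \<open>xdim S j\<close> columns, numbered
  from 0, and \<open>Bmat S t i j\<close> the matrix $B_{ij}(t)$ with \<open>xdim S i\<close> rows and \<open>udim S j\<close> columns;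
  entries beyond these bounds are never used. \<open>(j, i) \<in> EI S\<close> means that \<open>i\<close> measures \<open>x\<^sub>j\<close>.
\<close>

record network =
  subsys_num :: nat
  horizon :: nat
  xdim :: "nat \<Rightarrow> nat"
  udim :: "nat \<Rightarrow> nat"
  Amat :: "nat \<Rightarrow> nat \<Rightarrow> nat \<Rightarrow> nat \<Rightarrow> nat \<Rightarrow> real"
  Bmat :: "nat \<Rightarrow> nat \<Rightarrow> nat \<Rightarrow> nat \<Rightarrow> nat \<Rightarrow> real"
  EI :: "(nat \<times> nat) set"

definition subsys :: "network \<Rightarrow> nat set" where
  "subsys S = {1..subsys_num S}"

definition state_idx :: "network \<Rightarrow> idx set" where
  "state_idx S = {(t, i, k). t \<le> horizon S \<and> i \<in> subsys S \<and> k < xdim S i}"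

definition input_idx :: "network \<Rightarrow> idx set" where
  "input_idx S = {(t, i, k). t < horizon S \<and> i \<in> subsys S \<and> k < udim S i}"

text \<open>
  Time block \<open>s\<close> of a disturbance trajectory \<open>w\<close> holds $w(s-1)$; thus block 0 is
  $w(-1) = x(0)$, and $w(t)$ is block \<open>Suc t\<close>.
\<close>

definition dynamics :: "network \<Rightarrow> traj \<Rightarrow> traj \<Rightarrow> traj \<Rightarrow> bool" where
  "dynamics S x u w \<longleftrightarrow>
     (\<forall>i\<in>subsys S. \<forall>k<xdim S i. x (0, i, k) = w (0, i, k)) \<and>
     (\<forall>t<horizon S. \<forall>i\<in>subsys S. \<forall>k<xdim S i.
        x (Suc t, i, k) =
          (\<Sum>j\<in>subsys S. (\<Sum>l<xdim S j. Amat S t i j k l * x (t, j, l)) +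
                         (\<Sum>l<udim S j. Bmat S t i j k l * u (t, j, l)))
          + w (Suc t, i, k))"

definition lifted_form :: "network \<Rightarrow> idx mtx \<Rightarrow> idx mtx \<Rightarrow> bool" where
  "lifted_form S Bm Lm \<longleftrightarrow>
     (\<forall>x\<in>rvec (state_idx S). \<forall>u\<in>rvec (input_idx S). \<forall>w\<in>rvec (state_idx S).
        dynamics S x u w \<longleftrightarrow>
        x = (\<lambda>p\<in>state_idx S. mvec (input_idx S) Bm u p + mvec (state_idx S) Lm w p))"

definition meas_nbrs :: "network \<Rightarrow> nat \<Rightarrow> nat set" where
  "meas_nbrs S i = {j. (j, i) \<in> EI S}"

definition A_nbrs :: "network \<Rightarrow> nat \<Rightarrow> nat set" where
  "A_nbrs S i = {j \<in> subsys S. \<exists>t<horizon S. \<exists>k<xdim S i. \<exists>l<xdim S j. Amat S t i j k l \<noteq> 0}"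

definition B_nbrs :: "network \<Rightarrow> nat \<Rightarrow> nat set" where
  "B_nbrs S i = {j \<in> subsys S. \<exists>t<horizon S. \<exists>k<xdim S i. \<exists>l<udim S j. Bmat S t i j k l \<noteq> 0}"

definition N_set :: "network \<Rightarrow> nat \<Rightarrow> nat set" where
  "N_set S i = {j \<in> meas_nbrs S i. A_nbrs S j \<subseteq> meas_nbrs S i \<and>
                  (\<Union>k\<in>B_nbrs S j. meas_nbrs S k) \<subseteq> meas_nbrs S i}"

definition C_set :: "network \<Rightarrow> nat \<Rightarrow> nat set" where
  "C_set S i = meas_nbrs S i - N_set S i"

definition C_all :: "network \<Rightarrow> nat set" where
  "C_all S = (\<Union>i\<in>subsys S. C_set S i)"

definition contract_idx :: "network \<Rightarrow> idx set" where
  "contract_idx S = {(t, i, k) \<in> state_idx S. i \<in> C_all S}"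

definition Pi_C :: "network \<Rightarrow> traj \<Rightarrow> traj" where
  "Pi_C S x = restrict x (contract_idx S)"

text \<open>
  The entries of \<open>w\<close> and \<open>y\<close> on which \<open>\<phi>\<^sub>i(\<cdot>, t)\<close> may depend: $w_j^{-1:t-1}$ occupies the blocks
  \<open>0, \<dots>, t\<close> of \<open>w\<close>.
\<close>

definition w_info :: "network \<Rightarrow> nat \<Rightarrow> nat \<Rightarrow> idx set" where
  "w_info S i t = {(s, j, k). s \<le> t \<and> j \<in> N_set S i \<and> k < xdim S j}"

definition y_info :: "network \<Rightarrow> nat \<Rightarrow> nat \<Rightarrow> idx set" where
  "y_info S i t = {(s, j, k). s \<le> t \<and> j \<in> C_set S i \<and> k < xdim S j}"

type_synonym policy = "nat \<Rightarrow> nat \<Rightarrow> traj \<times> traj \<Rightarrow> nat \<Rightarrow> real"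

definition policies :: "network \<Rightarrow> policy set" where
  "policies S = {\<phi>. \<forall>i\<in>subsys S. \<forall>t<horizon S.
     \<phi> i t \<in> borel_rvec (w_info S i t) \<Otimes>\<^sub>M borel_rvec (y_info S i t) \<rightarrow>\<^sub>M borel_rvec {..<udim S i}}"

definition policy_input :: "network \<Rightarrow> policy \<Rightarrow> traj \<Rightarrow> traj \<Rightarrow> traj" where
  "policy_input S \<phi> w y =
     restrict (\<lambda>(t, i, k). \<phi> i t (restrict w (w_info S i t), restrict y (y_info S i t)) k)
       (input_idx S)"

definition surrogate_dynamics :: "network \<Rightarrow> traj \<Rightarrow> traj \<Rightarrow> traj \<Rightarrow> traj \<Rightarrow> bool" where
  "surrogate_dynamics S x u w v \<longleftrightarrow>
     (\<forall>i\<in>subsys S. \<forall>k<xdim S i. x (0, i, k) = w (0, i, k)) \<and>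
     (\<forall>t<horizon S. \<forall>i\<in>subsys S. \<forall>k<xdim S i.
        x (Suc t, i, k) =
          (\<Sum>j\<in>subsys S - C_set S i. \<Sum>l<xdim S j. Amat S t i j k l * x (t, j, l))
          + (\<Sum>j\<in>C_set S i. \<Sum>l<xdim S j. Amat S t i j k l * v (t, j, l))
          + (\<Sum>j\<in>subsys S. \<Sum>l<udim S j. Bmat S t i j k l * u (t, j, l))
          + w (Suc t, i, k))"

definition surrogate_lifted_form :: "network \<Rightarrow> idx mtx \<Rightarrow> idx mtx \<Rightarrow> idx mtx \<Rightarrow> bool" where
  "surrogate_lifted_form S Bt Lt Ht \<longleftrightarrow>
     (\<forall>x\<in>rvec (state_idx S). \<forall>u\<in>rvec (input_idx S). \<forall>w\<in>rvec (state_idx S). \<forall>v\<in>rvec (state_idx S).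
        surrogate_dynamics S x u w v \<longleftrightarrow>
        x = (\<lambda>p\<in>state_idx S. mvec (input_idx S) Bt u p + mvec (state_idx S) Lt w p
                              + mvec (contract_idx S) Ht (Pi_C S v) p))"

record 'p problem =
  objective :: "'p \<Rightarrow> ennreal"
  feasible :: "'p set"

record ocp_data =
  num_cons :: nat
  Fx :: "nat mtx"
  Fu :: "nat mtx"
  Fw :: "nat mtx"
  gvec :: "nat \<Rightarrow> real"
  Rx :: "idx mtx"
  Ru :: "idx mtx"

definition constraint :: "network \<Rightarrow> ocp_data \<Rightarrow> traj \<Rightarrow> traj \<Rightarrow> traj \<Rightarrow> bool" where
  "constraint S D x u w \<longleftrightarrow>
     (\<forall>r<num_cons D. mvec (state_idx S) (Fx D) x r + mvec (input_idx S) (Fu D) u r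
                  + mvec (state_idx S) (Fw D) w r \<le> gvec D r)"

definition cost :: "network \<Rightarrow> ocp_data \<Rightarrow> traj \<Rightarrow> traj \<Rightarrow> real" where
  "cost S D x u = quad_form (state_idx S) (Rx D) x + quad_form (input_idx S) (Ru D) u"

definition closed_loop ::
    "network \<Rightarrow> idx mtx \<Rightarrow> idx mtx \<Rightarrow> policy \<Rightarrow> traj \<Rightarrow> traj \<Rightarrow> traj \<Rightarrow> bool" where
  "closed_loop S Bm Lm \<phi> w x u \<longleftrightarrow>
     u = policy_input S \<phi> w (Pi_C S x) \<and>
     x = (\<lambda>p\<in>state_idx S. mvec (input_idx S) Bm u p + mvec (state_idx S) Lm w p)"

definition surrogate_loop ::
    "network \<Rightarrow> idx mtx \<Rightarrow> idx mtx \<Rightarrow> idx mtx \<Rightarrow> policy \<Rightarrow> traj \<Rightarrow> traj \<Rightarrow> traj \<Rightarrow> traj \<Rightarrow> bool" where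
  "surrogate_loop S Bt Lt Ht \<phi> w vC x u \<longleftrightarrow>
     u = policy_input S \<phi> w vC \<and>
     x = (\<lambda>p\<in>state_idx S. mvec (input_idx S) Bt u p + mvec (state_idx S) Lt w p
                           + mvec (contract_idx S) Ht vC p)"

text \<open>
  The costs are nonnegative, and a feasible input need not be bounded, so the expectations are
  taken in \<open>[0, \<infinity>]\<close>. The trajectories \<open>x\<close> and \<open>u\<close> are uniquely determined by \<open>\<phi>\<close> and \<open>w\<close> (lemma
  \<open>closed_loop_ex1\<close> below), which makes the definite description and the existential quantifier in
  the following definition unambiguous.
\<close>

definition original_problem ::
    "network \<Rightarrow> ocp_data \<Rightarrow> idx mtx \<Rightarrow> idx mtx \<Rightarrow> 'o measure \<Rightarrow> ('o \<Rightarrow> traj) \<Rightarrow> traj set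
     \<Rightarrow> policy problem" where
  "original_problem S D Bm Lm M w W =
     \<lparr>objective = (\<lambda>\<phi>. \<integral>\<^sup>+\<omega>. ennreal (case (THE (x, u). closed_loop S Bm Lm \<phi> (w \<omega>) x u) of
                                 (x, u) \<Rightarrow> cost S D x u) \<partial>M),
      feasible = {\<phi> \<in> policies S. \<forall>w\<in>W. \<exists>x u.
                    closed_loop S Bm Lm \<phi> w x u \<and> constraint S D x u w}\<rparr>"

definition surrogate_problem ::
    "network \<Rightarrow> ocp_data \<Rightarrow> idx mtx \<Rightarrow> idx mtx \<Rightarrow> idx mtx \<Rightarrow> 'o measure \<Rightarrow> ('o \<Rightarrow> traj) \<Rightarrow> ('o \<Rightarrow> traj)
     \<Rightarrow> traj set \<Rightarrow> traj set \<Rightarrow> policy problem" where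
  "surrogate_problem S D Bt Lt Ht M w v W VC =
     \<lparr>objective = (\<lambda>\<phi>. \<integral>\<^sup>+\<omega>. ennreal
                     (case (THE (x, u). surrogate_loop S Bt Lt Ht \<phi> (w \<omega>) (Pi_C S (v \<omega>)) x u) of
                        (x, u) \<Rightarrow> cost S D x u) \<partial>M),
      feasible = {\<phi> \<in> policies S. \<forall>w\<in>W. \<forall>vC\<in>VC. \<exists>x u.
                    surrogate_loop S Bt Lt Ht \<phi> w vC x u \<and> Pi_C S x \<in> VC \<and> constraint S D x u w}\<rparr>"

text \<open>
  The matrices assumed in \<^const>\<open>lifted_form\<close> and \<^const>\<open>surrogate_lifted_form\<close> exist, and the
  closed loop is well posed for every policy, continuous or not.
\<close>

lemma finite_subsys: "finite (subsys S)"
  by (simp add: subsys_def)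

lemma state_idx_eq: "state_idx S = {..horizon S} \<times> (SIGMA i:subsys S. {..<xdim S i})"
  by (auto simp: state_idx_def)

lemma input_idx_eq: "input_idx S = {..<horizon S} \<times> (SIGMA i:subsys S. {..<udim S i})"
  by (auto simp: input_idx_def)

lemma finite_state_idx: "finite (state_idx S)"
  by (simp add: state_idx_eq finite_subsys)

lemma finite_input_idx: "finite (input_idx S)"
  by (simp add: input_idx_eq finite_subsys)

lemma sum_state_slice:
  fixes f :: "nat \<Rightarrow> nat \<Rightarrow> real"
  assumes "t \<le> horizon S"
  shows "(\<Sum>(s, j, l)\<in>state_idx S. if s = t then f j l else 0) = (\<Sum>j\<in>subsys S. \<Sum>l<xdim S j. f j l)"
proof -
  have "(\<Sum>(s, j, l)\<in>state_idx S. if s = t then f j l else 0)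
      = (\<Sum>s\<le>horizon S. \<Sum>(j, l)\<in>(SIGMA i:subsys S. {..<xdim S i}). if s = t then f j l else 0)"
    unfolding state_idx_eq by (simp add: sum.cartesian_product)
  also have "\<dots> = (\<Sum>s\<le>horizon S. if s = t then (\<Sum>(j, l)\<in>(SIGMA i:subsys S. {..<xdim S i}). f j l) else 0)"
    by (rule sum.cong) auto
  also have "\<dots> = (\<Sum>(j, l)\<in>(SIGMA i:subsys S. {..<xdim S i}). f j l)"
    using assms by simp
  finally show ?thesis
    by (simp add: sum.Sigma finite_subsys)
qed

lemma sum_input_slice:
  fixes f :: "nat \<Rightarrow> nat \<Rightarrow> real"
  assumes "t < horizon S"
  shows "(\<Sum>(s, j, l)\<in>input_idx S. if s = t then f j l else 0) = (\<Sum>j\<in>subsys S. \<Sum>l<udim S j. f j l)"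
proof -
  have "(\<Sum>(s, j, l)\<in>input_idx S. if s = t then f j l else 0)
      = (\<Sum>s<horizon S. \<Sum>(j, l)\<in>(SIGMA i:subsys S. {..<udim S i}). if s = t then f j l else 0)"
    unfolding input_idx_eq by (simp add: sum.cartesian_product)
  also have "\<dots> = (\<Sum>s<horizon S. if s = t then (\<Sum>(j, l)\<in>(SIGMA i:subsys S. {..<udim S i}). f j l) else 0)"
    by (rule sum.cong) auto
  also have "\<dots> = (\<Sum>(j, l)\<in>(SIGMA i:subsys S. {..<udim S i}). f j l)"
    using assms by simp
  finally show ?thesis
    by (simp add: sum.Sigma finite_subsys)
qed

function resolvent :: "idx set \<Rightarrow> (idx \<Rightarrow> idx \<Rightarrow> real) \<Rightarrow> (idx \<Rightarrow> 'q \<Rightarrow> real) \<Rightarrow> idx \<Rightarrow> 'q \<Rightarrow> real" where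
  "resolvent I G E p q =
     (\<Sum>p'\<in>{p'\<in>I. fst p' < fst p}. G p p' * resolvent I G E p' q) + E p q"
  by pat_completeness auto
termination by (relation "Wellfounded.measure (\<lambda>(I, G, E, p, q). fst p)") auto

declare resolvent.simps [simp del]

lemma resolvent_iff:
  assumes "finite I"
  shows "(\<forall>p\<in>I. x p = (\<Sum>p'\<in>{p'\<in>I. fst p' < fst p}. G p p' * x p') + (\<Sum>q\<in>Q. E p q * z q))
     \<longleftrightarrow> (\<forall>p\<in>I. x p = (\<Sum>q\<in>Q. resolvent I G E p q * z q))" (is "?L \<longleftrightarrow> ?R")
proof -
  define r where "r p = (\<Sum>q\<in>Q. resolvent I G E p q * z q)" for p
  have r: "r p = (\<Sum>p'\<in>{p'\<in>I. fst p' < fst p}. G p p' * r p') + (\<Sum>q\<in>Q. E p q * z q)" for p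
  proof -
    have "r p = (\<Sum>q\<in>Q. ((\<Sum>p'\<in>{p'\<in>I. fst p' < fst p}. G p p' * resolvent I G E p' q) + E p q) * z q)"
      unfolding r_def by (subst resolvent.simps) simp
    also have "\<dots> = (\<Sum>q\<in>Q. \<Sum>p'\<in>{p'\<in>I. fst p' < fst p}. G p p' * (resolvent I G E p' q * z q)) + (\<Sum>q\<in>Q. E p q * z q)"
      by (simp add: distrib_right sum.distrib sum_distrib_right mult.assoc)
    also have "(\<Sum>q\<in>Q. \<Sum>p'\<in>{p'\<in>I. fst p' < fst p}. G p p' * (resolvent I G E p' q * z q))
       = (\<Sum>p'\<in>{p'\<in>I. fst p' < fst p}. G p p' * r p')"
      unfolding r_def sum_distrib_left by (rule sum.swap)
    finally show ?thesis .
  qed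
  show ?thesis
  proof
    assume L: ?L
    have "\<forall>p\<in>I. fst p = n \<longrightarrow> x p = r p" for n
    proof (induction n rule: less_induct)
      case (less n)
      show ?case
      proof (intro ballI impI)
        fix p assume p: "p \<in> I" "fst p = n"
        have "(\<Sum>p'\<in>{p'\<in>I. fst p' < fst p}. G p p' * x p') = (\<Sum>p'\<in>{p'\<in>I. fst p' < fst p}. G p p' * r p')"
          by (rule sum.cong) (use less p in auto)
        then show "x p = r p" using L p(1) r[of p] by simp
      qed
    qed
    then show ?R by (auto simp: r_def)
  next
    assume R: ?R
    show ?L
    proof
      fix p assume p: "p \<in> I"
      have "(\<Sum>p'\<in>{p'\<in>I. fst p' < fst p}. G p p' * x p') = (\<Sum>p'\<in>{p'\<in>I. fst p' < fst p}. G p p' * r p')"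
        by (rule sum.cong) (use R in \<open>auto simp: r_def\<close>)
      then show "x p = (\<Sum>p'\<in>{p'\<in>I. fst p' < fst p}. G p p' * x p') + (\<Sum>q\<in>Q. E p q * z q)"
        using R p r[of p] by (simp add: r_def)
    qed
  qed
qed

lemma surrogate_like_matrices:
  assumes K: "\<And>i. i \<in> subsys S \<Longrightarrow> K i \<subseteq> subsys S \<inter> C"
  defines "J \<equiv> {(t, i, k) \<in> state_idx S. i \<in> C}"
  shows "\<exists>Bt Lt Ht. \<forall>x\<in>rvec (state_idx S). \<forall>u w v.
     ((\<forall>i\<in>subsys S. \<forall>k<xdim S i. x (0, i, k) = w (0, i, k)) \<and>
     (\<forall>t<horizon S. \<forall>i\<in>subsys S. \<forall>k<xdim S i.
        x (Suc t, i, k) =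
          (\<Sum>j\<in>subsys S - K i. \<Sum>l<xdim S j. Amat S t i j k l * x (t, j, l))
          + (\<Sum>j\<in>K i. \<Sum>l<xdim S j. Amat S t i j k l * v (t, j, l))
          + (\<Sum>j\<in>subsys S. \<Sum>l<udim S j. Bmat S t i j k l * u (t, j, l))
          + w (Suc t, i, k))) \<longleftrightarrow>
     x = (\<lambda>p\<in>state_idx S. mvec (input_idx S) Bt u p + mvec (state_idx S) Lt w p + mvec J Ht v p)"
proof -
  let ?I = "state_idx S" and ?U = "input_idx S"
  define G where "G = (\<lambda>(s, i, k) (t, j, l).
    if s = Suc t \<and> j \<notin> K i then Amat S t i j k l else 0)"
  define E where "E = (\<lambda>(s, i, k) q. case q of
      Inl (t, j, l) \<Rightarrow> if s = Suc t then Bmat S t i j k l else 0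
    | Inr (Inl p) \<Rightarrow> if p = (s, i, k) then 1 else 0
    | Inr (Inr (t, j, l)) \<Rightarrow> if s = Suc t \<and> j \<in> K i then Amat S t i j k l else 0)"
  define Q where "Q = ?U <+> (?I <+> J)"
  define z :: "traj \<Rightarrow> traj \<Rightarrow> traj \<Rightarrow> idx + idx + idx \<Rightarrow> real"
    where "z u w v = case_sum u (case_sum w v)" for u w v
  have finJ: "finite J" using finite_state_idx unfolding J_def by (rule finite_subset[rotated]) auto
  have split: "(\<Sum>q\<in>Q. F q * z u w v q) = (\<Sum>q\<in>?U. F (Inl q) * u q)
      + ((\<Sum>q\<in>?I. F (Inr (Inl q)) * w q) + (\<Sum>q\<in>J. F (Inr (Inr q)) * v q))" for F u w v
    unfolding Q_def z_def
    by (simp add: sum.Plus finite_state_idx finite_input_idx finJ)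
  have E0: "(\<Sum>q\<in>Q. E (0, i, k) q * z u w v q) = w (0, i, k)"
    if "(0, i, k) \<in> ?I" for i k u w v
  proof -
    have "(\<Sum>q\<in>?I. (if q = (0, i, k) then 1 else 0) * w q) = w (0, i, k)"
      using that finite_state_idx by (simp add: if_distrib[of "\<lambda>a. a * _"] sum.delta cong: if_cong)
    moreover have "(\<Sum>q\<in>?U. E (0, i, k) (Inl q) * u q) = 0"
      by (rule sum.neutral) (auto simp: E_def)
    moreover have "(\<Sum>q\<in>J. E (0, i, k) (Inr (Inr q)) * v q) = 0"
      by (rule sum.neutral) (auto simp: E_def)
    ultimately show ?thesis
      unfolding split mvec_def by (simp add: E_def)
  qed
  have ES: "(\<Sum>q\<in>Q. E (Suc t, i, k) q * z u w v q) =
     (\<Sum>j\<in>K i. \<Sum>l<xdim S j. Amat S t i j k l * v (t, j, l))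
     + (\<Sum>j\<in>subsys S. \<Sum>l<udim S j. Bmat S t i j k l * u (t, j, l)) + w (Suc t, i, k)"
    if p: "(Suc t, i, k) \<in> ?I" for t i k u w v
  proof -
    have t: "t < horizon S" "i \<in> subsys S" using p by (auto simp: state_idx_def)
    have "(\<Sum>q\<in>?I. (if q = (Suc t, i, k) then 1 else 0) * w q) = w (Suc t, i, k)"
      using p finite_state_idx by (simp add: if_distrib[of "\<lambda>a. a * _"] sum.delta cong: if_cong)
    moreover have "(\<Sum>q\<in>?U. E (Suc t, i, k) (Inl q) * u q) =
        (\<Sum>(s, j, l)\<in>?U. if s = t then Bmat S t i j k l * u (t, j, l) else 0)"
      by (rule sum.cong) (auto simp: E_def)
    moreover have "\<dots> = (\<Sum>j\<in>subsys S. \<Sum>l<udim S j. Bmat S t i j k l * u (t, j, l))"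
      by (rule sum_input_slice) (rule t)
    moreover have "(\<Sum>q\<in>J. E (Suc t, i, k) (Inr (Inr q)) * v q) =
        (\<Sum>(s, j, l)\<in>?I. if s = t then (if j \<in> K i then Amat S t i j k l * v (t, j, l) else 0) else 0)"
      using K[OF t(2)] finite_state_idx
      by (intro sum.mono_neutral_cong_left) (auto simp: E_def J_def split: if_splits)
    moreover have "\<dots> = (\<Sum>j\<in>subsys S. \<Sum>l<xdim S j. if j \<in> K i then Amat S t i j k l * v (t, j, l) else 0)"
      by (rule sum_state_slice) (use t in auto)
    moreover have "\<dots> = (\<Sum>j\<in>K i. \<Sum>l<xdim S j. Amat S t i j k l * v (t, j, l))"
      using K[OF t(2)] finite_subsys by (intro sum.mono_neutral_cong_right) auto
    ultimately show ?thesis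
      unfolding split mvec_def by (simp add: E_def)
  qed
  have G0: "(\<Sum>p'\<in>{p'\<in>?I. fst p' < fst (0, i, k)}. G (0, i, k) p' * x p') = 0"
    for i k :: nat and x
    by simp
  have GS: "(\<Sum>p'\<in>{p'\<in>?I. fst p' < fst (Suc t, i, k)}. G (Suc t, i, k) p' * x p')
     = (\<Sum>j\<in>subsys S - K i. \<Sum>l<xdim S j. Amat S t i j k l * x (t, j, l))"
    if p: "(Suc t, i, k) \<in> ?I" for t i k x
  proof -
    have t: "t < horizon S" "i \<in> subsys S" using p by (auto simp: state_idx_def)
    have "(\<Sum>p'\<in>{p'\<in>?I. fst p' < fst (Suc t, i, k)}. G (Suc t, i, k) p' * x p') =
       (\<Sum>(s, j, l)\<in>?I. if s = t then (if j \<in> K i then 0 else Amat S t i j k l * x (t, j, l)) else 0)"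
      using finite_state_idx by (intro sum.mono_neutral_cong_left) (auto simp: G_def split: if_splits)
    also have "\<dots> = (\<Sum>j\<in>subsys S. \<Sum>l<xdim S j. if j \<in> K i then 0 else Amat S t i j k l * x (t, j, l))"
      by (rule sum_state_slice) (use t in auto)
    also have "\<dots> = (\<Sum>j\<in>subsys S - K i. \<Sum>l<xdim S j. Amat S t i j k l * x (t, j, l))"
      using finite_subsys by (intro sum.mono_neutral_cong_right) auto
    finally show ?thesis .
  qed
  define R where "R = resolvent ?I G E"
  show ?thesis
  proof (intro exI ballI allI)
    fix x u w v assume x: "x \<in> rvec ?I"
    have I: "(\<forall>p\<in>?I. P p) \<longleftrightarrow> (\<forall>i\<in>subsys S. \<forall>k<xdim S i. P (0, i, k)) \<and>
        (\<forall>t<horizon S. \<forall>i\<in>subsys S. \<forall>k<xdim S i. P (Suc t, i, k))"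
      (is "_ \<longleftrightarrow> ?r") for P
    proof (rule iffI)
      assume ?r
      show "\<forall>p\<in>?I. P p"
      proof
        fix p assume "p \<in> ?I"
        moreover obtain t i k where "p = (t, i, k)" by (cases p)
        ultimately show "P p" using \<open>?r\<close> by (cases t) (auto simp: state_idx_def)
      qed
    qed (auto simp: state_idx_def)
    have mem: "(0, i, k) \<in> ?I" "t < horizon S \<Longrightarrow> (Suc t, i, k) \<in> ?I"
      if "i \<in> subsys S" "k < xdim S i" for i k t
      using that by (auto simp: state_idx_def)
    have "((\<forall>i\<in>subsys S. \<forall>k<xdim S i. x (0, i, k) = w (0, i, k)) \<and>
     (\<forall>t<horizon S. \<forall>i\<in>subsys S. \<forall>k<xdim S i.
        x (Suc t, i, k) =
          (\<Sum>j\<in>subsys S - K i. \<Sum>l<xdim S j. Amat S t i j k l * x (t, j, l))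
          + (\<Sum>j\<in>K i. \<Sum>l<xdim S j. Amat S t i j k l * v (t, j, l))
          + (\<Sum>j\<in>subsys S. \<Sum>l<udim S j. Bmat S t i j k l * u (t, j, l))
          + w (Suc t, i, k))) \<longleftrightarrow>
      (\<forall>p\<in>?I. x p = (\<Sum>p'\<in>{p'\<in>?I. fst p' < fst p}. G p p' * x p') + (\<Sum>q\<in>Q. E p q * z u w v q))"
      unfolding I using mem by (simp add: G0 E0 GS ES add.assoc del: fst_conv)
    also have "\<dots> \<longleftrightarrow> (\<forall>p\<in>?I. x p = (\<Sum>q\<in>Q. R p q * z u w v q))"
      unfolding R_def by (rule resolvent_iff) (rule finite_state_idx)
    also have "\<dots> \<longleftrightarrow> (\<forall>p\<in>?I. x p = mvec ?U (\<lambda>p q. R p (Inl q)) u p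
      + mvec ?I (\<lambda>p q. R p (Inr (Inl q))) w p + mvec J (\<lambda>p q. R p (Inr (Inr q))) v p)"
      unfolding split mvec_def by (simp add: add.assoc)
    also have "\<dots> \<longleftrightarrow> x = (\<lambda>p\<in>?I. mvec ?U (\<lambda>p q. R p (Inl q)) u p
      + mvec ?I (\<lambda>p q. R p (Inr (Inl q))) w p + mvec J (\<lambda>p q. R p (Inr (Inr q))) v p)"
      using x by (auto simp: fun_eq_iff PiE_def extensional_def)
    finally show "((\<forall>i\<in>subsys S. \<forall>k<xdim S i. x (0, i, k) = w (0, i, k)) \<and>
     (\<forall>t<horizon S. \<forall>i\<in>subsys S. \<forall>k<xdim S i.
        x (Suc t, i, k) =
          (\<Sum>j\<in>subsys S - K i. \<Sum>l<xdim S j. Amat S t i j k l * x (t, j, l))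
          + (\<Sum>j\<in>K i. \<Sum>l<xdim S j. Amat S t i j k l * v (t, j, l))
          + (\<Sum>j\<in>subsys S. \<Sum>l<udim S j. Bmat S t i j k l * u (t, j, l))
          + w (Suc t, i, k))) \<longleftrightarrow> x = (\<lambda>p\<in>?I. mvec ?U (\<lambda>p q. R p (Inl q)) u p
      + mvec ?I (\<lambda>p q. R p (Inr (Inl q))) w p + mvec J (\<lambda>p q. R p (Inr (Inr q))) v p)" .
  qed
qed

lemma lifted_form_exists: "\<exists>Bm Lm. lifted_form S Bm Lm"
proof -
  obtain Bt Lt Ht where *: "\<forall>x\<in>rvec (state_idx S). \<forall>u w v :: traj.
     ((\<forall>i\<in>subsys S. \<forall>k<xdim S i. x (0, i, k) = w (0, i, k)) \<and>
     (\<forall>t<horizon S. \<forall>i\<in>subsys S. \<forall>k<xdim S i.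
        x (Suc t, i, k) =
          (\<Sum>j\<in>subsys S - {}. \<Sum>l<xdim S j. Amat S t i j k l * x (t, j, l))
          + (\<Sum>j\<in>{}. \<Sum>l<xdim S j. Amat S t i j k l * v (t, j, l))
          + (\<Sum>j\<in>subsys S. \<Sum>l<udim S j. Bmat S t i j k l * u (t, j, l))
          + w (Suc t, i, k))) \<longleftrightarrow>
     x = (\<lambda>p\<in>state_idx S. mvec (input_idx S) Bt u p + mvec (state_idx S) Lt w p
        + mvec {(t, i, k) \<in> state_idx S. i \<in> {}} Ht v p)"
    using surrogate_like_matrices[of S "\<lambda>_. {}" "{}", OF empty_subsetI]
    by (elim exE) (rule that)
  have "dynamics S x u w \<longleftrightarrow>
      x = (\<lambda>p\<in>state_idx S. mvec (input_idx S) Bt u p + mvec (state_idx S) Lt w p)"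
    if "x \<in> rvec (state_idx S)" for x u w
    using *[THEN bspec, OF that, THEN spec, of u, THEN spec, of w, THEN spec, of "\<lambda>_. 0"]
    by (simp add: dynamics_def sum.distrib mvec_def)
  then show ?thesis unfolding lifted_form_def by blast
qed

lemma surrogate_lifted_form_exists:
  assumes "EI S \<subseteq> subsys S \<times> subsys S"
  shows "\<exists>Bt Lt Ht. surrogate_lifted_form S Bt Lt Ht"
proof -
  have "C_set S i \<subseteq> subsys S \<inter> C_all S" if "i \<in> subsys S" for i
    using that assms by (auto simp: C_set_def meas_nbrs_def C_all_def)
  then obtain Bt Lt Ht where *: "\<forall>x\<in>rvec (state_idx S). \<forall>u w v. surrogate_dynamics S x u w v \<longleftrightarrow>
     x = (\<lambda>p\<in>state_idx S. mvec (input_idx S) Bt u p + mvec (state_idx S) Lt w p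
        + mvec (contract_idx S) Ht v p)"
    using surrogate_like_matrices[of S "C_set S" "C_all S"]
    unfolding surrogate_dynamics_def contract_idx_def by fastforce
  have "mvec (contract_idx S) Ht (Pi_C S v) = mvec (contract_idx S) Ht v" for v
    by (simp add: mvec_def Pi_C_def fun_eq_iff)
  then show ?thesis unfolding surrogate_lifted_form_def using *
    by (intro exI[of _ Bt] exI[of _ Lt] exI[of _ Ht]) simp
qed

lemma closed_loop_ex1:
  assumes EI: "EI S \<subseteq> subsys S \<times> subsys S" and BL: "lifted_form S Bm Lm"
    and w: "w \<in> rvec (state_idx S)"
  shows "\<exists>!(x, u). closed_loop S Bm Lm \<phi> w x u"
proof -
  let ?I = "state_idx S"
  define U where "U x = policy_input S \<phi> w (Pi_C S x)" for x
  define F where "F x = (\<lambda>p\<in>?I. mvec (input_idx S) Bm (U x) p + mvec ?I Lm w p)" for x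
  define eq where "eq n x y \<longleftrightarrow> (\<forall>p\<in>?I. fst p < n \<longrightarrow> x p = y p)" for n and x y :: traj
  have F: "F x \<in> rvec ?I" for x by (simp add: F_def)
  have U: "U x \<in> rvec (input_idx S)" for x by (simp add: U_def policy_input_def)
  have dyn: "dynamics S (F x) (U x) w" for x
    using BL F U w unfolding lifted_form_def by (auto simp: F_def)
  have causal_U: "U x (t, i, k) = U y (t, i, k)"
    if e: "eq (Suc t) x y" and t: "t < horizon S" "i \<in> subsys S" for x y t i k
  proof -
    have "y_info S i t \<subseteq> contract_idx S" "y_info S i t \<subseteq> {p \<in> ?I. fst p < Suc t}"
      using t EI by (auto simp: y_info_def contract_idx_def state_idx_def C_all_def C_set_def meas_nbrs_def)
    then have "restrict (Pi_C S x) (y_info S i t) = restrict (Pi_C S y) (y_info S i t)"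
      using e unfolding eq_def Pi_C_def by (intro restrict_ext) (auto simp: subset_iff)
    then show ?thesis by (simp add: U_def policy_input_def)
  qed
  have mono: "eq m x y" if "eq n x y" "m \<le> n" for m n x y
    using that by (auto simp: eq_def)
  have causal: "eq (Suc n) (F x) (F y)" if "eq n x y" for n x y
    using that
  proof (induction n)
    case 0
    show ?case unfolding eq_def
    proof (intro ballI impI)
      fix p assume p: "p \<in> ?I" "fst p < Suc 0"
      then obtain i k where "p = (0, i, k)" "i \<in> subsys S" "k < xdim S i" by (auto simp: state_idx_def)
      then show "F x p = F y p" using dyn[of x] dyn[of y] by (simp add: dynamics_def)
    qed
  next
    case (Suc n)
    have IH: "eq (Suc n) (F x) (F y)" using Suc mono by simp
    show ?case unfolding eq_def
    proof (intro ballI impI)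
      fix p assume p: "p \<in> ?I" "fst p < Suc (Suc n)"
      show "F x p = F y p"
      proof (cases "fst p < Suc n")
        case True then show ?thesis using IH p by (simp add: eq_def)
      next
        case False
        then obtain i k where ik: "p = (Suc n, i, k)" "i \<in> subsys S" "k < xdim S i" "n < horizon S"
          using p by (auto simp: state_idx_def)
        have 1: "F x (n, j, l) = F y (n, j, l)" if "j \<in> subsys S" "l < xdim S j" for j l
          using IH that ik(4) by (auto simp: eq_def state_idx_def)
        have 2: "U x (n, j, l) = U y (n, j, l)" if "j \<in> subsys S" for j l
          using causal_U Suc.prems ik(4) that by blast
        show ?thesis
          using dyn[of x] dyn[of y] ik 1 2 by (simp add: dynamics_def)
      qed
    qed
  qed
  have ext: "x = y" if "eq (Suc (horizon S)) x y" "x \<in> rvec ?I" "y \<in> rvec ?I" for x y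
    using that(2,3) by (rule PiE_ext) (use that(1) in \<open>auto simp: eq_def state_idx_def\<close>)
  define x where "x = (F ^^ Suc (horizon S)) (F (\<lambda>_. 0))"
  have "eq n ((F ^^ n) (F y)) ((F ^^ n) y)" for n y
  proof (induction n)
    case 0 show ?case by (simp add: eq_def)
  next
    case (Suc n) then show ?case using causal by simp
  qed
  from this[of "Suc (horizon S)" "F (\<lambda>_. 0)"]
  have "eq (Suc (horizon S)) (F x) x" unfolding x_def by (simp add: funpow_swap1)
  then have fp: "F x = x" using F by (intro ext) (auto simp: x_def)
  have cl: "closed_loop S Bm Lm \<phi> w y u \<longleftrightarrow> u = U y \<and> y = F y" for y u
    by (auto simp: closed_loop_def U_def F_def)
  have uniq: "y = x" if "y = F y" for y
  proof -
    have "eq n y x" for n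
    proof (induction n)
      case (Suc n) then show ?case using causal[of n y x] that fp by simp
    qed (simp add: eq_def)
    then show ?thesis using F fp that by (metis ext)
  qed
  show ?thesis
    by (rule ex1I[of _ "(x, U x)"]) (use fp uniq in \<open>auto simp: cl\<close>)
qed

end

theory Submission
  imports Defs
begin

text \<open>
  Fix a disturbance \<open>w \<in> W\<close> and let \<open>x\<close> be the true closed-loop state. Feeding the surrogate loop with
  \<open>v\<^sub>C = Pi_C S x\<close> reproduces \<open>x\<close>, because replacing the fictitious states by the true ones turns
  the surrogate dynamics into the true dynamics
  (\<open>dynamics_iff_surrogate_dynamics_self\<close>). The surrogate constraints thus carry over to \<open>x\<close> as soon as
  \<open>Pi_C S x\<close> is known to lie in the contract set \<open>Pi_C S ` V\<close>, and this is the content of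
  the proof.

  Feasibility says that \<open>v\<^sub>C \<mapsto> Pi_C S x'\<close>, with \<open>x'\<close> the surrogate state, maps the contract set into
  itself, and \<open>Pi_C S x\<close> is a fixed point of this map. A fixed-point theorem for continuous maps does
  not help, since policies are only measurable; causality does. The block \<open>t + 1\<close> of \<open>x'\<close> depends
  on \<open>v\<^sub>C\<close> only through the blocks up to \<open>t\<close>, so if \<open>v\<^sub>C\<close> agrees with the true state on the first
  \<open>n\<close> blocks, then the surrogate state agrees with it on the first \<open>n + 1\<close>
  (\<open>surrogate_loop_tracks_closed_loop\<close>). Iterating the map from an arbitrary point of the nonempty
  contract set therefore reaches \<open>Pi_C S x\<close> in finitely many steps, without leaving the contract
  set.
\<close>

definition agree_below :: "idx set \<Rightarrow> nat \<Rightarrow> traj \<Rightarrow> traj \<Rightarrow> bool" where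
  "agree_below J n x y \<longleftrightarrow> (\<forall>p\<in>J. fst p < n \<longrightarrow> x p = y p)"

lemma agree_below_mono: "agree_below J n x y \<Longrightarrow> J' \<subseteq> J \<Longrightarrow> m \<le> n \<Longrightarrow> agree_below J' m x y"
  by (auto simp: agree_below_def)

lemma agree_below_Pi_C: "agree_below (contract_idx S) n (Pi_C S x) (Pi_C S y) \<longleftrightarrow>
    agree_below (contract_idx S) n x y"
  by (auto simp: agree_below_def Pi_C_def)

lemma contract_idx_subset: "contract_idx S \<subseteq> state_idx S"
  by (auto simp: contract_idx_def)

lemma agree_below_state_idx_eq:
  assumes "agree_below (state_idx S) (Suc (horizon S)) x y"
    and "x \<in> rvec (state_idx S)" "y \<in> rvec (state_idx S)"
  shows "x = y"
  using assms(2,3)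
  by (rule PiE_ext) (use assms(1) in \<open>auto simp: agree_below_def state_idx_def\<close>)

lemma Pi_C_eqI:
  assumes "agree_below (contract_idx S) (Suc (horizon S)) x y"
  shows "Pi_C S x = Pi_C S y"
  unfolding Pi_C_def
  by (rule restrict_ext)
    (use assms in \<open>auto simp: agree_below_def contract_idx_def state_idx_def\<close>)

lemma C_set_subset_subsys:
  assumes "EI S \<subseteq> subsys S \<times> subsys S"
  shows "C_set S i \<subseteq> subsys S"
  using assms by (auto simp: C_set_def meas_nbrs_def)

lemma y_info_subset_contract_idx:
  assumes "EI S \<subseteq> subsys S \<times> subsys S" "i \<in> subsys S" "t \<le> horizon S"
  shows "y_info S i t \<subseteq> contract_idx S"
  using assms by (auto simp: y_info_def contract_idx_def state_idx_def C_all_def C_set_def meas_nbrs_def)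

lemma dynamics_iff_surrogate_dynamics_self:
  assumes "EI S \<subseteq> subsys S \<times> subsys S"
  shows "dynamics S x u w \<longleftrightarrow> surrogate_dynamics S x u w x"
proof -
  have "(\<Sum>j\<in>subsys S - C_set S i. f j) + (\<Sum>j\<in>C_set S i. f j) = (\<Sum>j\<in>subsys S. f j)"
    for f :: "nat \<Rightarrow> real" and i
    by (rule sum.subset_diff[symmetric, OF C_set_subset_subsys[OF assms] finite_subsys])
  then show ?thesis
    unfolding dynamics_def surrogate_dynamics_def by (simp only: sum.distrib)
qed

text \<open>
  Block \<open>t\<close> of the input is computed from the measurements up to and including time \<open>t\<close>, hence there
  is no delay here; the delay that drives the iteration comes from the dynamics.
\<close>

lemma policy_input_causal:
  assumes "EI S \<subseteq> subsys S \<times> subsys S"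
    and "agree_below (contract_idx S) n y y'"
  shows "agree_below (input_idx S) n (policy_input S \<phi> w y) (policy_input S \<phi> w y')"
proof -
  have "restrict y (y_info S i t) = restrict y' (y_info S i t)"
    if "i \<in> subsys S" "t < horizon S" "t < n" for i t
  proof (rule restrict_ext)
    fix p assume "p \<in> y_info S i t"
    moreover from this have "p \<in> contract_idx S"
      using y_info_subset_contract_idx[OF assms(1), of i t] that by auto
    ultimately show "y p = y' p"
      using assms(2) that by (auto simp: agree_below_def y_info_def)
  qed
  then show ?thesis
    by (auto simp: agree_below_def policy_input_def input_idx_def)
qed

text \<open>
  Each block is computed from the preceding blocks of state, input and fictitious state, which is
  where one block of agreement is gained. Of the fictitious trajectories only the components in the
  sets \<open>C_set S i\<close>, hence in \<open>contract_idx S\<close>, enter.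
\<close>

lemma surrogate_dynamics_causal:
  assumes "EI S \<subseteq> subsys S \<times> subsys S"
    and dyn: "surrogate_dynamics S x u w v" "surrogate_dynamics S x' u' w v'"
    and u: "agree_below (input_idx S) n u u'"
    and v: "agree_below (contract_idx S) n v v'"
  shows "agree_below (state_idx S) (Suc n) x x'"
proof -
  have "agree_below (state_idx S) (Suc m) x x'" if "m \<le> n" for m
    using that
  proof (induction m)
    case 0
    show ?case
      using dyn by (auto simp: agree_below_def state_idx_def surrogate_dynamics_def)
  next
    case (Suc m)
    then have IH: "agree_below (state_idx S) (Suc m) x x'" by simp
    have "x (Suc m, i, k) = x' (Suc m, i, k)"
      if ik: "m < horizon S" "i \<in> subsys S" "k < xdim S i" for i k
    proof -
      have "x (m, j, l) = x' (m, j, l)" if "j \<in> subsys S - C_set S i" "l < xdim S j" for j l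
        using IH that ik by (auto simp: agree_below_def state_idx_def)
      moreover have "v (m, j, l) = v' (m, j, l)" if "j \<in> C_set S i" "l < xdim S j" for j l
      proof -
        have "(m, j, l) \<in> contract_idx S"
          using that ik C_set_subset_subsys[OF assms(1), of i]
          by (auto simp: contract_idx_def state_idx_def C_all_def)
        then show ?thesis
          using v Suc.prems by (simp add: agree_below_def)
      qed
      moreover have "u (m, j, l) = u' (m, j, l)" if "j \<in> subsys S" "l < udim S j" for j l
        using u that ik Suc.prems by (auto simp: agree_below_def input_idx_def)
      ultimately show ?thesis
        using dyn ik by (simp add: surrogate_dynamics_def)
    qed
    then have "\<forall>p\<in>state_idx S. fst p = Suc m \<longrightarrow> x p = x' p"
      by (auto simp: state_idx_def)
    with IH show ?case
      by (auto simp: agree_below_def less_Suc_eq)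
  qed
  then show ?thesis by simp
qed

lemma policy_input_in_rvec: "policy_input S \<phi> w y \<in> rvec (input_idx S)"
  by (simp add: policy_input_def)

lemma closed_loopD:
  assumes "closed_loop S Bm Lm \<phi> w x u"
  shows "u = policy_input S \<phi> w (Pi_C S x)"
    and "x = (\<lambda>p\<in>state_idx S. mvec (input_idx S) Bm u p + mvec (state_idx S) Lm w p)"
    and "u \<in> rvec (input_idx S)" and "x \<in> rvec (state_idx S)"
proof -
  show u: "u = policy_input S \<phi> w (Pi_C S x)"
    by (rule conjunct1[OF assms[unfolded closed_loop_def]])
  show x: "x = (\<lambda>p\<in>state_idx S. mvec (input_idx S) Bm u p + mvec (state_idx S) Lm w p)"
    by (rule conjunct2[OF assms[unfolded closed_loop_def]])
  show "u \<in> rvec (input_idx S)"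
    by (subst u) (rule policy_input_in_rvec)
  show "x \<in> rvec (state_idx S)"
    by (subst x) simp
qed

lemma surrogate_loopD:
  assumes "surrogate_loop S Bt Lt Ht \<phi> w vC x u"
  shows "u = policy_input S \<phi> w vC"
    and "x = (\<lambda>p\<in>state_idx S. mvec (input_idx S) Bt u p + mvec (state_idx S) Lt w p
                               + mvec (contract_idx S) Ht vC p)"
    and "u \<in> rvec (input_idx S)" and "x \<in> rvec (state_idx S)"
  using assms by (simp_all add: surrogate_loop_def policy_input_in_rvec)

lemma closed_loop_dynamics:
  assumes "lifted_form S Bm Lm" "w \<in> rvec (state_idx S)" "closed_loop S Bm Lm \<phi> w x u"
  shows "dynamics S x u w"
  using assms(1)[unfolded lifted_form_def, rule_format, OF _ _ assms(2)] closed_loopD[OF assms(3)]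
  by blast

lemma surrogate_loop_dynamics:
  assumes "surrogate_lifted_form S Bt Lt Ht" "w \<in> rvec (state_idx S)" "v \<in> rvec (state_idx S)"
    and "surrogate_loop S Bt Lt Ht \<phi> w (Pi_C S v) x u"
  shows "surrogate_dynamics S x u w v"
  using assms(1)[unfolded surrogate_lifted_form_def, rule_format, OF _ _ assms(2,3)]
    surrogate_loopD[OF assms(4)]
  by blast

text \<open>
  The closed loop is itself a surrogate trajectory, with fictitious states \<open>x\<close>, so the two causality
  lemmas compare it with the surrogate loop. With \<open>n\<close> the horizon or more, the conclusion says that
  the two trajectories coincide.
\<close>

lemma surrogate_loop_tracks_closed_loop:
  assumes EI: "EI S \<subseteq> subsys S \<times> subsys S"
    and BL: "lifted_form S Bm Lm" and BLH: "surrogate_lifted_form S Bt Lt Ht"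
    and w: "w \<in> rvec (state_idx S)" and v: "v \<in> rvec (state_idx S)"
    and cl: "closed_loop S Bm Lm \<phi> w x u"
    and sl: "surrogate_loop S Bt Lt Ht \<phi> w (Pi_C S v) x' u'"
    and agree: "agree_below (contract_idx S) n v x"
  shows "agree_below (state_idx S) (Suc n) x' x"
proof (rule surrogate_dynamics_causal[OF EI])
  show "surrogate_dynamics S x' u' w v"
    by (rule surrogate_loop_dynamics[OF BLH w v sl])
  show "surrogate_dynamics S x u w x"
    using closed_loop_dynamics[OF BL w cl] by (simp only: dynamics_iff_surrogate_dynamics_self[OF EI])
  have "agree_below (contract_idx S) n (Pi_C S v) (Pi_C S x)"
    using agree by (simp only: agree_below_Pi_C)
  from policy_input_causal[OF EI this, of \<phi> w] show "agree_below (input_idx S) n u' u"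
    by (simp only: closed_loopD(1)[OF cl, symmetric] surrogate_loopD(1)[OF sl, symmetric])
qed (rule agree)

theorem proposition1:
  fixes S :: network and D :: ocp_data
    and Bm Lm Bt Lt Ht :: "idx mtx"
    and M :: "'o measure" and w v :: "'o \<Rightarrow> traj"
    and W V :: "traj set" and \<phi> :: policy
  assumes "horizon S \<ge> 1"
    and "EI S \<subseteq> subsys S \<times> subsys S"
    and "lifted_form S Bm Lm"
    and "surrogate_lifted_form S Bt Lt Ht"
    and "sym_psd (state_idx S) (Rx D)"
    and "sym_psd (input_idx S) (Ru D)"
    and "prob_space M"
    and "w \<in> M \<rightarrow>\<^sub>M borel_rvec (state_idx S)"
    and "v \<in> M \<rightarrow>\<^sub>M borel_rvec (state_idx S)"
    and "\<forall>p\<in>state_idx S. integrable M (\<lambda>\<omega>. w \<omega> p) \<and> (\<integral>\<omega>. w \<omega> p \<partial>M) = 0"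
    and "W = measure_support (powertop_real (state_idx S)) (distr M (borel_rvec (state_idx S)) w)"
    and "convex_rvec (state_idx S) W"
    and "compactin (powertop_real (state_idx S)) W"
    and "powertop_real (state_idx S) interior_of W \<noteq> {}"
    and "V = measure_support (powertop_real (state_idx S)) (distr M (borel_rvec (state_idx S)) v)"
    and "convex_rvec (state_idx S) V"
    and "compactin (powertop_real (state_idx S)) V"
    and "V \<noteq> {}"
    and "measure_support (prod_topology (powertop_real (state_idx S)) (powertop_real (state_idx S)))
           (distr M (borel_rvec (state_idx S) \<Otimes>\<^sub>M borel_rvec (state_idx S)) (\<lambda>\<omega>. (w \<omega>, v \<omega>)))
         = W \<times> V"
    and "\<phi> \<in> feasible (surrogate_problem S D Bt Lt Ht M w v W (Pi_C S ` V))"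
  shows "\<phi> \<in> feasible (original_problem S D Bm Lm M w W)"
proof -
  note EI = assms(2) and BL = assms(3) and BLH = assms(4)
  have W: "W \<subseteq> rvec (state_idx S)" and V: "V \<subseteq> rvec (state_idx S)"
    unfolding assms(11,15) by (auto simp: measure_support_def)
  have surrogate: "\<exists>x u. surrogate_loop S Bt Lt Ht \<phi> w0 vC x u \<and> Pi_C S x \<in> Pi_C S ` V
        \<and> constraint S D x u w0" if "w0 \<in> W" "vC \<in> Pi_C S ` V" for w0 vC
    using assms(20) that by (auto simp: surrogate_problem_def)
  have "\<exists>x u. closed_loop S Bm Lm \<phi> w0 x u \<and> constraint S D x u w0" if w0: "w0 \<in> W" for w0
  proof -
    have w0': "w0 \<in> rvec (state_idx S)" using W w0 by auto
    from closed_loop_ex1[OF EI BL w0'] obtain x u where cl: "closed_loop S Bm Lm \<phi> w0 x u"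
      by blast
    have track: "agree_below (state_idx S) (Suc n) x' x"
      if "v0 \<in> V" "agree_below (contract_idx S) n v0 x"
        "surrogate_loop S Bt Lt Ht \<phi> w0 (Pi_C S v0) x' u'" for n v0 x' u'
      using surrogate_loop_tracks_closed_loop[OF EI BL BLH w0' _ cl that(3,2)] V that(1) by auto
    \<comment> \<open>The iterates of the contract map; only their contract components matter, so each is
        represented by some trajectory in \<open>V\<close> with these components.\<close>
    have "\<exists>v0\<in>V. agree_below (contract_idx S) n v0 x" for n
    proof (induction n)
      case 0
      show ?case using assms(18) by (auto simp: agree_below_def)
    next
      case (Suc n)
      then obtain v0 where v0: "v0 \<in> V" "agree_below (contract_idx S) n v0 x" by blast
      with surrogate[OF w0, of "Pi_C S v0"] obtain x' u' v1
        where x': "surrogate_loop S Bt Lt Ht \<phi> w0 (Pi_C S v0) x' u'"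
          and v1: "v1 \<in> V" "Pi_C S x' = Pi_C S v1" by blast
      have "agree_below (contract_idx S) (Suc n) x' x"
        using track[OF v0 x'] contract_idx_subset by (rule agree_below_mono) simp
      then have "agree_below (contract_idx S) (Suc n) v1 x"
        using v1(2) by (metis agree_below_Pi_C)
      with v1(1) show ?case by blast
    qed
    then obtain v0 where v0: "v0 \<in> V" "agree_below (contract_idx S) (Suc (horizon S)) v0 x"
      by blast
    with surrogate[OF w0, of "Pi_C S v0"] obtain x' u'
      where x': "surrogate_loop S Bt Lt Ht \<phi> w0 (Pi_C S v0) x' u'" and c: "constraint S D x' u' w0"
      by blast
    have "x' = x"
    proof (rule agree_below_state_idx_eq)
      show "agree_below (state_idx S) (Suc (horizon S)) x' x"
        using track[OF v0 x'] by (rule agree_below_mono) simp_all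
    qed (rule surrogate_loopD(4)[OF x'], rule closed_loopD(4)[OF cl])
    moreover have "u' = u"
      using surrogate_loopD(1)[OF x'] closed_loopD(1)[OF cl] Pi_C_eqI[OF v0(2)] by metis
    ultimately show ?thesis using cl c by blast
  qed
  with assms(20) show ?thesis
    by (auto simp: original_problem_def surrogate_problem_def)
qed

end
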